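(* Let $K$ be a field of characteristic $0$, $n\ge1$, and let $(U,\cdot,\omega)$ be a strong $n$-Lie-Poisson algebra over $K$. Endow $U$ with the new skew-symmetric $(n+1)$-multiplication $\tilde\omega=\mathrm{id}\wedge\omega$, i.e. $$\tilde\omega(u_0,u_1,\ldots,u_n)=\sum_{i=0}^n(-1)^iu_i\cdot\omega(u_0,\ldots,\widehat{u_i},\ldots,u_n).$$ Then $(U,\tilde\omega)$ is an $(n+1)$-Lie algebra. It satisfies the identity $f^{\tilde\omega}=0$, i.e. $$\sum_{i=1}^{n+2}(-1)^i\tilde\omega(u_1,\ldots,u_n,v_i)\cdot\tilde\omega(v_1,\ldots,\widehat{v_i},\ldots,v_{n+2})=0$$ for all $u_i,v_j\in U$. If $U$ has a unit $1$, then it satisfies one more identity: for all $u,u',u_1,\ldots,u_n\in U$, $$\tilde\omega(u\cdot u',u_1,\ldots,u_n)-u\cdot\tilde\omega(u',u_1,\ldots,u_n)-u'\cdot\tilde\omega(u,u_1,\ldots,u_n)=-(u\cdot u')\cdot\tilde\omega(1,u_1,\ldots,u_n).$$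
   Context: For $m\ge1$, an $m$-Lie algebra $(U,\omega)$ is a vector space with a skew-symmetric $m$-linear map $\omega$ satisfying $$\omega(u_1,\ldots,u_{m-1},\omega(v_1,\ldots,v_m))=\sum_{i=1}^m\omega(v_1,\ldots,v_{i-1},\omega(u_1,\ldots,u_{m-1},v_i),v_{i+1},\ldots,v_m)$$ (for $m=1$ any linear map is allowed). An $n$-Lie-Poisson algebra $(U,\cdot,\omega)$ consists of an associative commutative algebra $(U,\cdot)$ and an $n$-Lie algebra $(U,\omega)$ such that $\omega(u\cdot u',u_2,\ldots,u_n)=u\cdot\omega(u',u_2,\ldots,u_n)+u'\cdot\omega(u,u_2,\ldots,u_n)$. It is strong if for all $u_i,v_j\in U$ $$\sum_{i=1}^{n+1}(-1)^i\omega(u_1,\ldots,u_{n-1},v_i)\cdot\omega(v_1,\ldots,\widehat{v_i},\ldots,v_{n+1})=0,$$ where a hat means omission. *)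

theory Defs
  imports Complex_Main "HOL-Combinatorics.Permutations"
begin

(* An m-ary operation on U is a function on lists; only its values on lists of length m are
   constrained or used. Arguments are numbered from 0. *)

definition omit :: "nat \<Rightarrow> 'a list \<Rightarrow> 'a list" where
  "omit i xs = take i xs @ drop (Suc i) xs"

definition multilinear ::
  "('k::field \<Rightarrow> 'u::ab_group_add \<Rightarrow> 'u) \<Rightarrow> nat \<Rightarrow> ('u list \<Rightarrow> 'u) \<Rightarrow> bool" where
  "multilinear scale m \<omega> \<longleftrightarrow>
     (\<forall>xs i. length xs = m \<longrightarrow> i < m \<longrightarrow>
        Vector_Spaces.linear scale scale (\<lambda>x. \<omega> (xs[i := x])))"

definition skew_symmetric ::
  "('k::field \<Rightarrow> 'u::ab_group_add \<Rightarrow> 'u) \<Rightarrow> nat \<Rightarrow> ('u list \<Rightarrow> 'u) \<Rightarrow> bool" where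
  "skew_symmetric scale m \<omega> \<longleftrightarrow>
     (\<forall>xs p. length xs = m \<longrightarrow> p permutes {..<m} \<longrightarrow>
        \<omega> (permute_list p xs) = scale (of_int (sign p)) (\<omega> xs))"

locale n_Lie_algebra = vector_space scale
  for scale :: "'k::field \<Rightarrow> 'u::ab_group_add \<Rightarrow> 'u" +
  fixes m :: nat and \<omega> :: "'u list \<Rightarrow> 'u"
  assumes arity_pos: "1 \<le> m"
    and multilinear: "multilinear scale m \<omega>"
    and skew_symmetric: "skew_symmetric scale m \<omega>"
    and fundamental_identity:
      "\<And>us vs. length us = m - 1 \<Longrightarrow> length vs = m \<Longrightarrow>
         \<omega> (us @ [\<omega> vs]) = (\<Sum>i<m. \<omega> (vs[i := \<omega> (us @ [vs ! i])]))"

(* Class comm_ring does not include a unit. *)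
locale assoc_comm_algebra = vector_space scale
  for scale :: "'k::field \<Rightarrow> 'u::comm_ring \<Rightarrow> 'u" +
  assumes scale_mult_left: "\<And>a x y. scale a (x * y) = scale a x * y"

locale n_Lie_Poisson_algebra =
  assoc_comm_algebra scale + n_Lie_algebra scale n \<omega>
  for scale :: "'k::field \<Rightarrow> 'u::comm_ring \<Rightarrow> 'u" and n :: nat and \<omega> :: "'u list \<Rightarrow> 'u" +
  assumes Leibniz:
    "\<And>u u' us. length us = n - 1 \<Longrightarrow>
       \<omega> ((u * u') # us) = u * \<omega> (u' # us) + u' * \<omega> (u # us)"

(* The identity f^\<omega> = 0 for an m-ary \<omega>. Entry i (from 0) is entry i + 1 in the usual
   numbering from 1, hence the exponent Suc i. *)
definition f_identity ::
  "('k::field \<Rightarrow> 'u::comm_ring \<Rightarrow> 'u) \<Rightarrow> nat \<Rightarrow> ('u list \<Rightarrow> 'u) \<Rightarrow> bool" where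
  "f_identity scale m \<omega> \<longleftrightarrow>
     (\<forall>us vs. length us = m - 1 \<longrightarrow> length vs = m + 1 \<longrightarrow>
        (\<Sum>i<m + 1. scale ((- 1) ^ Suc i) (\<omega> (us @ [vs ! i]) * \<omega> (omit i vs))) = 0)"

locale strong_n_Lie_Poisson_algebra = n_Lie_Poisson_algebra +
  assumes strong: "f_identity scale n \<omega>"

definition id_wedge ::
  "('k::field \<Rightarrow> 'u::comm_ring \<Rightarrow> 'u) \<Rightarrow> ('u list \<Rightarrow> 'u) \<Rightarrow> 'u list \<Rightarrow> 'u" where
  "id_wedge scale \<omega> us =
     (\<Sum>i<length us. scale ((- 1) ^ i) (us ! i * \<omega> (omit i us)))"

end

theory Submission
  imports Defs
begin

text \<open>
  Fix \<open>u\<close> and put \<open>D y = \<omega>~(u, y)\<close>, where \<open>\<omega>~ = id \<and> \<omega>\<close>, and \<open>c = (-1)^n \<omega>(u)\<close>. Then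
  \<open>D y = \<Sum>\<^sub>i \<plusminus> u\<^sub>i \<omega>(u without u\<^sub>i, y) + c y\<close>, a combination of derivations up to the term \<open>c y\<close>, so that
  \<open>D (x y) = x D y + y D x - c x y\<close>. When \<open>D\<close> is inserted into one argument \<open>w\<close> of \<open>\<omega>\<close>, the Leibniz
  rule produces the cross terms \<open>\<Sum>\<^sub>i \<plusminus> \<omega>(u without u\<^sub>i, w) \<omega>(.., u\<^sub>i, ..)\<close>, which the strong identity
  collapses to \<open>- c \<omega>(.., w, ..)\<close>, cancelling one of the terms that \<open>c w\<close> contributes. What is left of
  the fundamental identity is an alternating sum over ordered pairs of arguments whose summand is
  symmetric in the pair, so it vanishes. The same antisymmetry disposes of the \<open>c\<close>-part of \<open>f = 0\<close>;
  in the other part, exchanging the two members of the pair exposes the strong identity.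
\<close>

section \<open>Signs and alternating sums over deleted entries\<close>

definition signed :: "nat \<Rightarrow> 'a::ab_group_add \<Rightarrow> 'a" where
  "signed k x = (if even k then x else - x)"

lemma signed_0 [simp]: "signed 0 x = x"
  and signed_Suc [simp]: "signed (Suc k) x = - signed k x"
  and signed_zero [simp]: "signed k 0 = 0"
  and signed_minus [simp]: "signed k (- x) = - signed k x"
  and signed_add: "signed k (x + y) = signed k x + signed k y"
  and signed_commute: "signed j (signed k x) = signed k (signed j x)"
  and signed_signed [simp]: "signed k (signed k x) = x"
  by (simp_all add: signed_def)

lemma signed_mult_left: "signed k (x * y) = signed k x * (y :: 'a::comm_ring)"
  and signed_mult_right: "signed k (x * y) = x * signed k (y :: 'a::comm_ring)"
  by (simp_all add: signed_def)

lemma signed_sum: "signed k (sum f A) = (\<Sum>x\<in>A. signed k (f x))"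
  by (simp add: signed_def sum_negf)

lemma (in vector_space) scale_minus_one_power: "scale ((- 1) ^ k) x = signed k x"
  by (simp add: signed_def minus_one_power_iff)

text \<open>Common shape of both sums in the theorem: \<open>G x l = x * \<omega> l\<close> gives
  \<open>id_wedge\<close>, and \<open>G x l = \<omega> (us @ [x]) * \<omega> l\<close> gives the
  f-identity up to a global sign.\<close>

definition alt_sum :: "('a \<Rightarrow> 'a list \<Rightarrow> 'b::ab_group_add) \<Rightarrow> 'a list \<Rightarrow> 'b" where
  "alt_sum G v = (\<Sum>i<length v. signed i (G (v ! i) (omit i v)))"

lemma omit_0 [simp]: "omit 0 (x # v) = v"
  and omit_Suc [simp]: "omit (Suc i) (x # v) = x # omit i v"
  by (simp_all add: omit_def)

lemma length_omit: "i < length v \<Longrightarrow> length v = Suc (length (omit i v))"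
  by (simp add: omit_def)

lemma alt_sum_Nil [simp]: "alt_sum G [] = 0"
  by (simp add: alt_sum_def)

text \<open>Deleting a later entry keeps the head and shifts the index by one, hence the minus sign.
  With \<open>G\<close> generalised, this recursion drives the list inductions below.\<close>

lemma alt_sum_Cons [simp]: "alt_sum G (x # v) = G x v - alt_sum (\<lambda>y l. G y (x # l)) v"
  unfolding alt_sum_def length_Cons sum.lessThan_Suc_shift by (simp add: sum_negf)

text \<open>The length restriction matters because \<open>\<omega>\<close> is constrained only at
  its own arity.\<close>

lemma alt_sum_cong:
  assumes "\<And>x l. length v = Suc (length l) \<Longrightarrow> G x l = H x l"
  shows "alt_sum G v = alt_sum H v"
  unfolding alt_sum_def
proof (intro sum.cong refl)
  fix i assume "i \<in> {..<length v}"
  then show "signed i (G (v ! i) (omit i v)) = signed i (H (v ! i) (omit i v))"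
    using assms[of "omit i v" "v ! i"] length_omit[of i v] by simp
qed

lemma alt_sum_add: "alt_sum (\<lambda>x l. G x l + H x l) v = alt_sum G v + alt_sum H v"
  by (simp add: alt_sum_def signed_add sum.distrib)

lemma alt_sum_minus: "alt_sum (\<lambda>x l. - G x l) v = - alt_sum G v"
  by (simp add: alt_sum_def sum_negf)

lemma alt_sum_diff: "alt_sum (\<lambda>x l. G x l - H x l) v = alt_sum G v - alt_sum H v"
  using alt_sum_add[of G "\<lambda>x l. - H x l"] by (simp add: alt_sum_minus)

lemma alt_sum_zero [simp]: "alt_sum (\<lambda>x l. 0) v = 0"
  by (simp add: alt_sum_def)

lemma alt_sum_sum: "alt_sum (\<lambda>x l. \<Sum>i\<in>I. G i x l) v = (\<Sum>i\<in>I. alt_sum (G i) v)"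
  unfolding alt_sum_def signed_sum by (rule sum.swap)

lemma alt_sum_signed: "alt_sum (\<lambda>x l. signed k (G x l)) v = signed k (alt_sum G v)"
  by (simp add: signed_def alt_sum_minus)

lemma alt_sum_swap:
  "alt_sum (\<lambda>x l. alt_sum (\<lambda>y m. F x l y m) v) u = alt_sum (\<lambda>y m. alt_sum (\<lambda>x l. F x l y m) u) v"
  unfolding alt_sum_def[of _ v] alt_sum_sum alt_sum_signed ..

lemma alt_sum_mult_left: "alt_sum (\<lambda>x l. c * G x l) v = (c :: 'a::comm_ring) * alt_sum G v"
  by (simp add: alt_sum_def signed_mult_right sum_distrib_left)

lemma alt_sum_mult_right: "alt_sum (\<lambda>x l. G x l * c) v = alt_sum G v * (c :: 'a::comm_ring)"
  using alt_sum_mult_left[of c G v] by (simp add: mult.commute)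

lemma alt_sum_additive:
  assumes "Modules.additive f"
  shows "f (alt_sum G v) = alt_sum (\<lambda>x l. f (G x l)) v"
proof -
  interpret Modules.additive f by fact
  show ?thesis by (auto simp: alt_sum_def sum signed_def minus intro!: sum.cong)
qed

lemma alt_sum_snoc:
  "alt_sum G (v @ [x]) = alt_sum (\<lambda>y l. G y (l @ [x])) v + signed (length v) (G x v)"
  by (induction v arbitrary: G) simp_all

text \<open>Deleting two entries in one order or in the other leaves the same list but with opposite
  signs.\<close>

lemma alt_sum_symmetric:
  assumes "\<And>x y l. F x y l = F y x l"
  shows "alt_sum (\<lambda>x l. alt_sum (\<lambda>y m. F x y m) l) v = 0"
  using assms
proof (induction v arbitrary: F)
  case (Cons z v)
  have "alt_sum (\<lambda>x l. alt_sum (\<lambda>y m. F x y (z # m)) l) v = 0"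
    by (rule Cons.IH) (rule Cons.prems)
  \<comment> \<open>The terms deleting \<open>z\<close> first thereby agree with those deleting
    \<open>z\<close> second, and cancel them.\<close>
  moreover have "F z = (\<lambda>y. F y z)"
    using Cons.prems by (simp add: fun_eq_iff)
  ultimately show ?case
    by (simp add: alt_sum_diff)
qed simp

text \<open>Polarisation of \<open>alt_sum_symmetric\<close>: its summand is taken to be
  \<open>F x y m + F y x m\<close>.\<close>

lemma alt_sum_flip:
  "alt_sum (\<lambda>x l. alt_sum (\<lambda>y m. F x y m) l) v = - alt_sum (\<lambda>x l. alt_sum (\<lambda>y m. F y x m) l) v"
  using alt_sum_symmetric[of "\<lambda>x y m. F x y m + F y x m" v]
  by (simp add: alt_sum_add add.commute eq_neg_iff_add_eq_0)

section \<open>Applying a map to one entry at a time, as on the right of the fundamental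
  identity\<close>

definition slot_sum :: "('a list \<Rightarrow> 'b::comm_monoid_add) \<Rightarrow> ('a \<Rightarrow> 'a) \<Rightarrow> 'a list \<Rightarrow> 'b" where
  "slot_sum \<Phi> E v = (\<Sum>i<length v. \<Phi> (v[i := E (v ! i)]))"

lemma slot_sum_Nil [simp]: "slot_sum \<Phi> E [] = 0"
  by (simp add: slot_sum_def)

lemma slot_sum_Cons [simp]:
  "slot_sum \<Phi> E (x # v) = \<Phi> (E x # v) + slot_sum (\<lambda>l. \<Phi> (x # l)) E v"
  unfolding slot_sum_def length_Cons sum.lessThan_Suc_shift by simp

lemma slot_sum_diff:
  "slot_sum (\<lambda>l. \<Phi> l - \<Psi> l) E v = slot_sum \<Phi> E v - slot_sum \<Psi> E (v :: 'a list)"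
  for \<Phi> :: "'a list \<Rightarrow> 'b::ab_group_add"
  by (simp add: slot_sum_def sum_subtractf)

text \<open>The entry changed by \<open>E\<close> is either the deleted one or one of those passed
  on to \<open>G x\<close>.\<close>

lemma slot_sum_alt_sum:
  "slot_sum (alt_sum G) E v = alt_sum (\<lambda>x l. G (E x) l + slot_sum (G x) E l) v"
proof (induction v arbitrary: G)
  case (Cons z v)
  then show ?case
    by (simp add: slot_sum_diff alt_sum_add)
qed simp

section \<open>Skew symmetry and multilinearity\<close>

text \<open>Deleting \<open>a\<close> or \<open>b\<close> leaves the same list on both sides, but at
  an index differing by one; for any other deleted entry the sign comes from
  \<open>G\<close>.\<close>

lemma alt_sum_swap_adjacent:
  fixes xs ys :: "'a list" and G :: "'a \<Rightarrow> 'a list \<Rightarrow> 'b::ab_group_add"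
  assumes "\<And>x as bs. length as + length bs + 1 = length xs + length ys \<Longrightarrow>
      G x (as @ a # b # bs) = - G x (as @ b # a # bs)"
  shows "alt_sum G (xs @ a # b # ys) = - alt_sum G (xs @ b # a # ys)"
  using assms
proof (induction xs arbitrary: G)
  case Nil
  have "alt_sum (\<lambda>x l. G x (a # b # l)) ys = alt_sum (\<lambda>x l. - G x (b # a # l)) ys"
    using Nil[of "[]"] by (intro alt_sum_cong) simp
  then show ?case by (simp add: alt_sum_minus)
next
  case (Cons z xs)
  have "alt_sum (\<lambda>x l. G x (z # l)) (xs @ a # b # ys)
      = - alt_sum (\<lambda>x l. G x (z # l)) (xs @ b # a # ys)"
  proof (rule Cons.IH)
    fix x and as bs :: "'a list" assume "length as + length bs + 1 = length xs + length ys"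
    then show "G x (z # as @ a # b # bs) = - G x (z # as @ b # a # bs)"
      using Cons.prems[of "z # as" bs x] by simp
  qed
  then show ?case using Cons.prems[of xs ys z] by simp
qed

lemma permute_list_transpose_adjacent:
  "permute_list (Transposition.transpose (length xs) (Suc (length xs))) (xs @ a # b # ys) = xs @ b # a # ys"
proof (rule nth_equalityI)
  fix i
  assume "i < length (permute_list (Transposition.transpose (length xs) (Suc (length xs))) (xs @ a # b # ys))"
  moreover have "Transposition.transpose (length xs) (Suc (length xs)) permutes {..<length (xs @ a # b # ys)}"
    by (intro permutes_swap_id) auto
  ultimately show "permute_list (Transposition.transpose (length xs) (Suc (length xs))) (xs @ a # b # ys) ! i
      = (xs @ b # a # ys) ! i"
    by (auto simp: permute_list_nth transpose_def nth_append nth_Cons' split: if_splits)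
qed simp

context vector_space
begin

lemma linear_diff_map:
  assumes "Vector_Spaces.linear scale scale f" and "Vector_Spaces.linear scale scale g"
  shows "Vector_Spaces.linear scale scale (\<lambda>x. f x - g x)"
  using assms vector_space_pair.linear_compose_sub vector_space_pair.intro vector_space_axioms by blast

lemma linear_alt_sum:
  assumes "\<And>y l. length v = Suc (length l) \<Longrightarrow> Vector_Spaces.linear scale scale (\<lambda>x. H x y l)"
  shows "Vector_Spaces.linear scale scale (\<lambda>x. alt_sum (H x) v)"
proof -
  interpret endo: vector_space_pair scale scale by unfold_locales
  show ?thesis
    unfolding alt_sum_def
  proof (intro endo.linear_compose_sum ballI)
    fix i assume "i \<in> {..<length v}"
    then have "Vector_Spaces.linear scale scale (\<lambda>x. H x (v ! i) (omit i v))"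
      using assms length_omit by auto
    then show "Vector_Spaces.linear scale scale (\<lambda>x. signed i (H x (v ! i) (omit i v)))"
      by (cases "even i") (simp_all add: signed_def endo.linear_compose_neg)
  qed
qed

text \<open>The two hypotheses treat the term in which the varying entry is deleted and those in
  which it stays.\<close>

lemma linear_alt_sum_slot:
  assumes "Vector_Spaces.linear scale scale (\<lambda>x. G x (xs @ ys))"
    and "\<And>y as bs. length as + length bs + 1 = length xs + length ys \<Longrightarrow>
      Vector_Spaces.linear scale scale (\<lambda>x. G y (as @ x # bs))"
  shows "Vector_Spaces.linear scale scale (\<lambda>x. alt_sum G (xs @ x # ys))"
  using assms
proof (induction xs arbitrary: G)
  case Nil
  have "Vector_Spaces.linear scale scale (\<lambda>x. alt_sum (\<lambda>y l. G y (x # l)) ys)"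
    using Nil(2)[of "[]"] by (intro linear_alt_sum) simp
  with Nil(1) show ?case
    by (simp add: linear_diff_map)
next
  case (Cons z xs)
  have "Vector_Spaces.linear scale scale (\<lambda>x. alt_sum (\<lambda>y l. G y (z # l)) (xs @ x # ys))"
    using Cons.prems(1) Cons.prems(2)[of "z # as" bs for as bs]
    by (intro Cons.IH) simp_all
  moreover have "Vector_Spaces.linear scale scale (\<lambda>x. G z (xs @ x # ys))"
    using Cons.prems(2)[of xs ys z] by simp
  ultimately show ?case
    by (simp add: linear_diff_map)
qed

lemma multilinear_iff:
  "multilinear scale m \<omega> \<longleftrightarrow>
    (\<forall>xs ys. length xs + length ys + 1 = m \<longrightarrow> Vector_Spaces.linear scale scale (\<lambda>x. \<omega> (xs @ x # ys)))"
  (is "?L \<longleftrightarrow> ?R")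
proof
  assume L: ?L
  show ?R
  proof (intro allI impI)
    fix xs ys :: "'b list" assume "length xs + length ys + 1 = m"
    then show "Vector_Spaces.linear scale scale (\<lambda>x. \<omega> (xs @ x # ys))"
      using L[unfolded multilinear_def, rule_format, of "xs @ 0 # ys" "length xs"] by simp
  qed
next
  assume ?R
  then show ?L by (auto simp: multilinear_def upd_conv_take_nth_drop)
qed

lemma skew_symmetric_swap:
  assumes "skew_symmetric scale m \<omega>" and "length xs + length ys + 2 = m"
  shows "\<omega> (xs @ a # b # ys) = - \<omega> (xs @ b # a # ys)"
proof -
  have "Transposition.transpose (length xs) (Suc (length xs)) permutes {..<m}"
    using assms(2) by (intro permutes_swap_id) auto
  then have "\<omega> (xs @ b # a # ys) =
      scale (of_int (sign (Transposition.transpose (length xs) (Suc (length xs))))) (\<omega> (xs @ a # b # ys))"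
    using assms(1)[unfolded skew_symmetric_def, rule_format, of "xs @ a # b # ys"
        "Transposition.transpose (length xs) (Suc (length xs))"] assms(2)
    by (simp add: permute_list_transpose_adjacent)
  then show ?thesis by (simp add: sign_swap_id)
qed

text \<open>Adjacent transpositions generate the symmetric group, and the sign is
  multiplicative.\<close>

lemma skew_symmetricI:
  assumes swap: "\<And>xs ys a b. length xs + length ys + 2 = m \<Longrightarrow>
      \<omega> (xs @ a # b # ys) = - \<omega> (xs @ b # a # ys)"
  shows "skew_symmetric scale m \<omega>"
proof -
  define Q where "Q p \<longleftrightarrow> p permutes {..<m} \<and>
    (\<forall>xs. length xs = m \<longrightarrow> \<omega> (permute_list p xs) = scale (of_int (sign p)) (\<omega> xs))" for p
  have Q_comp: "Q (p \<circ> q)" if "Q p" "Q q" for p q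
  proof -
    have p: "p permutes {..<m}" and q: "q permutes {..<m}" using that by (auto simp: Q_def)
    then have "permutation p" "permutation q"
      using permutation_permutes by blast+
    then show ?thesis
      using that p q by (auto simp: Q_def permutes_compose permute_list_compose sign_compose mult.commute)
  qed
  have Q_adj: "Q (Transposition.transpose k (Suc k))" if "Suc k < m" for k
    unfolding Q_def
  proof (intro conjI allI impI)
    show "Transposition.transpose k (Suc k) permutes {..<m}"
      using that by (intro permutes_swap_id) auto
    fix v :: "'b list" assume v: "length v = m"
    define xs a b ys where "xs = take k v" and "a = v ! k" and "b = v ! Suc k" and "ys = drop (Suc (Suc k)) v"
    have "v = xs @ a # b # ys" and "length xs = k" and "length xs + length ys + 2 = m"
      using v that by (simp_all add: xs_def a_def b_def ys_def Cons_nth_drop_Suc)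
    then show "\<omega> (permute_list (Transposition.transpose k (Suc k)) v)
        = scale (of_int (sign (Transposition.transpose k (Suc k)))) (\<omega> v)"
      using permute_list_transpose_adjacent[of xs a b ys] swap[of xs ys a b]
      by (simp add: sign_swap_id)
  qed
  have Q_less: "Q (Transposition.transpose a b)" if "a < b" "b < m" for a b
    using that
  proof (induction b)
    case (Suc b)
    show ?case
    proof (cases "a = b")
      case True
      with Q_adj Suc.prems show ?thesis by simp
    next
      case False
      let ?t = "Transposition.transpose b (Suc b)"
      \<comment> \<open>Conjugating by the adjacent transposition \<open>?t\<close> carries
        \<open>b\<close> to \<open>Suc b\<close> and fixes \<open>a\<close>.\<close>
      have "Transposition.transpose a (Suc b) = ?t \<circ> (Transposition.transpose a b \<circ> ?t)"
        using False Suc.prems by (auto simp: fun_eq_iff transpose_def)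
      moreover have "Q (?t \<circ> (Transposition.transpose a b \<circ> ?t))"
        using False Suc Q_adj[of b] by (intro Q_comp) auto
      ultimately show ?thesis by (simp only:)
    qed
  qed simp
  have "Q p" if "p permutes {..<m}" for p
    using that finite_lessThan
  proof (induction rule: permutes_induct)
    case id
    show ?case by (simp add: Q_def permutes_id[unfolded id_def] id_def)
  next
    case (swap a b p)
    have "Q (Transposition.transpose a b)"
      using swap Q_less[of a b] Q_less[of b a]
      by (cases "a < b") (auto simp: transpose_commute)
    with swap Q_comp show ?case by blast
  qed
  then show ?thesis by (auto simp: skew_symmetric_def Q_def)
qed

end

section \<open>The wedge and the f-identity as alternating sums\<close>

lemma (in assoc_comm_algebra) id_wedge_eq_alt_sum: "id_wedge scale \<omega> = alt_sum (\<lambda>x l. x * \<omega> l)"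
  by (simp add: fun_eq_iff id_wedge_def alt_sum_def scale_minus_one_power)

lemma (in assoc_comm_algebra) scale_mult_right: "scale a (x * y) = x * scale a y"
  by (metis mult.commute scale_mult_left)

text \<open>The exponent \<open>Suc i\<close> in place of \<open>i\<close> only negates the whole
  sum.\<close>

lemma (in assoc_comm_algebra) f_identity_iff:
  "f_identity scale m \<omega> \<longleftrightarrow>
    (\<forall>us vs. length us = m - 1 \<longrightarrow> length vs = m + 1 \<longrightarrow>
      alt_sum (\<lambda>x l. \<omega> (us @ [x]) * \<omega> l) vs = 0)"
  by (simp add: f_identity_def scale_minus_one_power alt_sum_def sum_negf del: sum.lessThan_Suc)

section \<open>The wedge over an n-Lie-Poisson algebra\<close>

context n_Lie_Poisson_algebra
begin

lemma skew_swap: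
  "length xs + length ys + 2 = n \<Longrightarrow> \<omega> (xs @ a # b # ys) = - \<omega> (xs @ b # a # ys)"
  using skew_symmetric by (rule skew_symmetric_swap)

text \<open>Moving \<open>x\<close> to the front of \<open>ys\<close> takes \<open>length ys\<close>
  adjacent swaps.\<close>

lemma skew_move:
  assumes "length xs + length ys + length zs + 1 = n"
  shows "\<omega> (xs @ ys @ x # zs) = signed (length ys) (\<omega> (xs @ x # ys @ zs))"
  using assms
proof (induction ys arbitrary: xs)
  case (Cons y ys)
  have "\<omega> ((xs @ [y]) @ ys @ x # zs) = signed (length ys) (\<omega> ((xs @ [y]) @ x # ys @ zs))"
    using Cons.prems by (intro Cons.IH) simp
  then show ?case
    using skew_swap[of xs "ys @ zs" y x] Cons.prems by simp
qed simp

lemma additive_slot: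
  assumes "length xs + length ys + 1 = n"
  shows "Modules.additive (\<lambda>x. \<omega> (xs @ x # ys))"
proof -
  have "Vector_Spaces.linear scale scale (\<lambda>x. \<omega> (xs @ x # ys))"
    using multilinear assms by (auto simp: multilinear_iff)
  then show ?thesis
    by (auto simp: linear_iff_module_hom module_hom_iff intro: additive.intro)
qed

text \<open>The slot is moved to the front, where the Leibniz rule is assumed, and back; the sign is
  the same in all terms.\<close>

lemma Leibniz_slot:
  assumes "length xs + length ys + 1 = n"
  shows "\<omega> (xs @ (u * u') # ys) = u * \<omega> (xs @ u' # ys) + u' * \<omega> (xs @ u # ys)"
  using assms skew_move[of "[]" xs ys] Leibniz[of "xs @ ys" u u']
  by (simp add: signed_add signed_mult_right)

lemma multilinear_id_wedge: "multilinear scale (n + 1) (id_wedge scale \<omega>)"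
  unfolding multilinear_iff id_wedge_eq_alt_sum
proof (intro allI impI linear_alt_sum_slot)
  fix xs ys :: "'u list"
  show "Vector_Spaces.linear scale scale (\<lambda>x. x * \<omega> (xs @ ys))"
    by (simp add: linear_iff_module_hom module_hom_iff module_axioms distrib_right scale_mult_left)
next
  fix xs ys as bs :: "'u list" and y :: 'u
  assume "length xs + length ys + 1 = n + 1" and "length as + length bs + 1 = length xs + length ys"
  then have "Vector_Spaces.linear scale scale (\<lambda>x. \<omega> (as @ x # bs))"
    using multilinear by (auto simp: multilinear_iff)
  then show "Vector_Spaces.linear scale scale (\<lambda>x. y * \<omega> (as @ x # bs))"
    by (simp add: linear_iff_module_hom module_hom_iff distrib_left scale_mult_right)
qed

lemma skew_symmetric_id_wedge: "skew_symmetric scale (n + 1) (id_wedge scale \<omega>)"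
  unfolding id_wedge_eq_alt_sum
proof (intro skew_symmetricI alt_sum_swap_adjacent)
  fix xs ys as bs :: "'u list" and a b x :: 'u
  assume "length xs + length ys + 2 = n + 1" and "length as + length bs + 1 = length xs + length ys"
  then show "x * \<omega> (as @ a # b # bs) = - (x * \<omega> (as @ b # a # bs))"
    using skew_swap[of as bs a b] by simp
qed

text \<open>Isolates the one term with \<open>y\<close> outside \<open>\<omega>\<close>; its sign is
  that of the index \<open>length us\<close> of \<open>y\<close>.\<close>

lemma id_wedge_snoc:
  "id_wedge scale \<omega> (us @ [y]) =
    alt_sum (\<lambda>a m. a * \<omega> (m @ [y])) us + signed (length us) (\<omega> us) * y"
  by (simp add: id_wedge_eq_alt_sum alt_sum_snoc signed_mult_right mult.commute[of _ y])

text \<open>The sum over \<open>us\<close> is a derivation in the last entry. For the remaining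
  term, the Leibniz expression counts \<open>signed n (\<omega> us) * (x * y)\<close> twice instead
  of once.\<close>

lemma id_wedge_snoc_mult:
  assumes "length us = n"
  shows "id_wedge scale \<omega> (us @ [x * y]) =
    x * id_wedge scale \<omega> (us @ [y]) + y * id_wedge scale \<omega> (us @ [x])
      - signed n (\<omega> us) * (x * y)"
proof -
  have "alt_sum (\<lambda>a m. a * \<omega> (m @ [x * y])) us =
      alt_sum (\<lambda>a m. x * (a * \<omega> (m @ [y])) + y * (a * \<omega> (m @ [x]))) us"
    using assms by (intro alt_sum_cong) (simp add: Leibniz_slot[of _ "[]"] algebra_simps)
  then show ?thesis
    using assms by (simp only: id_wedge_snoc alt_sum_add alt_sum_mult_left) (simp add: algebra_simps)
qed

text \<open>Moving \<open>c\<close> from the front into the gap at \<open>i\<close> costs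
  \<open>(-1)^i\<close>, which cancels the alternating sign.\<close>

lemma alt_sum_mult_skew_Cons:
  assumes "length l = n"
  shows "alt_sum (\<lambda>y m. y * \<omega> (c # m)) l = (\<Sum>i<n. l ! i * \<omega> (l[i := c]))"
  unfolding alt_sum_def assms
proof (intro sum.cong refl)
  fix i assume "i \<in> {..<n}"
  then show "signed i (l ! i * \<omega> (c # omit i l)) = l ! i * \<omega> (l[i := c])"
    using assms skew_move[of "[]" "take i l" "drop (Suc i) l" c]
    by (simp add: upd_conv_take_nth_drop omit_def signed_mult_right)
qed

text \<open>Only the term deleting the first argument fails to be a derivation; its defect is
  \<open>- (u * u') * \<omega> us\<close>. As \<open>\<omega>\<close> kills \<open>e\<close>, the
  value \<open>\<omega> us\<close> is the wedge at \<open>e # us\<close>.\<close>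

lemma id_wedge_unit:
  assumes "\<And>x. e * x = x" and "length us = n"
  shows "id_wedge scale \<omega> ((u * u') # us) - u * id_wedge scale \<omega> (u' # us)
      - u' * id_wedge scale \<omega> (u # us) = - ((u * u') * id_wedge scale \<omega> (e # us))"
proof -
  \<comment> \<open>Leibniz on \<open>e * e = e\<close> gives
    \<open>\<omega> (e # l) = \<omega> (e # l) + \<omega> (e # l)\<close>.\<close>
  have e: "\<omega> (e # l) = 0" if "length us = Suc (length l)" for l
    using Leibniz[of l e e] that assms by simp
  have "alt_sum (\<lambda>y l. y * \<omega> (e # l)) us = alt_sum (\<lambda>y l. 0) us"
    using e by (intro alt_sum_cong) simp
  moreover have "alt_sum (\<lambda>y l. y * \<omega> ((u * u') # l)) us
      = alt_sum (\<lambda>y l. u * (y * \<omega> (u' # l)) + u' * (y * \<omega> (u # l))) us"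
    using assms(2) by (intro alt_sum_cong) (simp add: Leibniz algebra_simps)
  ultimately show ?thesis
    by (simp only: id_wedge_eq_alt_sum alt_sum_Cons alt_sum_add alt_sum_mult_left assms(1))
      (simp add: algebra_simps)
qed

end

section \<open>Consequences of the strong identity\<close>

context strong_n_Lie_Poisson_algebra
begin

lemma strong_alt_sum:
  "length us = n - 1 \<Longrightarrow> length vs = n + 1 \<Longrightarrow> alt_sum (\<lambda>x l. \<omega> (us @ [x]) * \<omega> l) vs = 0"
  using strong by (simp add: f_identity_iff)

text \<open>The strong identity for \<open>xs @ ys\<close> and \<open>us @ [w]\<close>, solved for
  the part that keeps \<open>w\<close>; the term deleting \<open>w\<close>, at index
  \<open>n\<close>, becomes the right-hand side.\<close>

lemma strong_slot:
  assumes us: "length us = n" and len: "length xs + length ys + 1 = n"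
  shows "alt_sum (\<lambda>a m. \<omega> (xs @ a # ys) * \<omega> (m @ [w])) us
    = - (signed n (\<omega> us) * \<omega> (xs @ w # ys))"
proof -
  have move: "\<omega> (xs @ ys @ [a]) = signed (length ys) (\<omega> (xs @ a # ys))" for a
    using skew_move[of xs ys "[]" a] len by simp
  have "alt_sum (\<lambda>a m. \<omega> (xs @ ys @ [a]) * \<omega> (m @ [w])) us
      + signed n (\<omega> (xs @ ys @ [w]) * \<omega> us) = 0"
    using strong_alt_sum[of "xs @ ys" "us @ [w]"] us len by (simp add: alt_sum_snoc)
  \<comment> \<open>Moving the last argument back into its slot costs the same sign in every term,
    so the sign factors out.\<close>
  then have "signed (length ys) (alt_sum (\<lambda>a m. \<omega> (xs @ a # ys) * \<omega> (m @ [w])) us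
      + signed n (\<omega> us) * \<omega> (xs @ w # ys)) = 0"
    by (simp add: move alt_sum_signed signed_commute[of n] mult.commute
        flip: signed_mult_left signed_mult_right signed_add)
  then show ?thesis
    by (simp add: signed_def eq_neg_iff_add_eq_0 neg_eq_iff_add_eq_0 split: if_splits)
qed

text \<open>Leibniz splits every product in two. By \<open>strong_slot\<close> the cross terms
  cancel \<open>signed n (\<omega> us) * \<omega> (xs @ w # ys)\<close>, one half of the last
  product.\<close>

lemma slot_id_wedge:
  assumes us: "length us = n" and len: "length xs + length ys + 1 = n"
  shows "\<omega> (xs @ id_wedge scale \<omega> (us @ [w]) # ys) =
    alt_sum (\<lambda>a m. a * \<omega> (xs @ \<omega> (m @ [w]) # ys)) us + w * \<omega> (xs @ signed n (\<omega> us) # ys)"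
proof -
  interpret slot: Modules.additive "\<lambda>x. \<omega> (xs @ x # ys)"
    using len by (rule additive_slot)
  have "\<omega> (xs @ id_wedge scale \<omega> (us @ [w]) # ys) =
      alt_sum (\<lambda>a m. \<omega> (xs @ (a * \<omega> (m @ [w])) # ys)) us + \<omega> (xs @ (signed n (\<omega> us) * w) # ys)"
    by (simp add: id_wedge_snoc slot.add us alt_sum_additive[OF slot.additive_axioms])
  also have "\<dots> = alt_sum (\<lambda>a m. a * \<omega> (xs @ \<omega> (m @ [w]) # ys)) us
      + alt_sum (\<lambda>a m. \<omega> (xs @ a # ys) * \<omega> (m @ [w])) us
      + (signed n (\<omega> us) * \<omega> (xs @ w # ys) + w * \<omega> (xs @ signed n (\<omega> us) # ys))"
    by (simp add: Leibniz_slot[OF len] alt_sum_add mult.commute)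
  finally show ?thesis
    by (simp add: strong_slot[OF us len])
qed

lemma slot_sum_id_wedge:
  assumes us: "length us = n" and l: "length l = n"
  shows "slot_sum \<omega> (\<lambda>y. id_wedge scale \<omega> (us @ [y])) l =
    id_wedge scale \<omega> (us @ [\<omega> l]) - signed n (\<omega> us) * \<omega> l
      + alt_sum (\<lambda>y m. y * \<omega> (signed n (\<omega> us) # m)) l"
proof -
  have "slot_sum \<omega> (\<lambda>y. id_wedge scale \<omega> (us @ [y])) l =
    (\<Sum>i<n. alt_sum (\<lambda>a m. a * \<omega> (l[i := \<omega> (m @ [l ! i])])) us + l ! i * \<omega> (l[i := signed n (\<omega> us)]))"
    unfolding slot_sum_def l
    by (intro sum.cong) (simp_all add: upd_conv_take_nth_drop l slot_id_wedge us)
  also have "\<dots> = alt_sum (\<lambda>a m. a * (\<Sum>i<n. \<omega> (l[i := \<omega> (m @ [l ! i])]))) us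
      + alt_sum (\<lambda>y m. y * \<omega> (signed n (\<omega> us) # m)) l"
    by (simp add: sum.distrib alt_sum_sum sum_distrib_left alt_sum_mult_skew_Cons l)
  \<comment> \<open>Each \<open>m\<close> is \<open>us\<close> with one entry deleted, so it has the
    \<open>n - 1\<close> entries that the fundamental identity of \<open>\<omega>\<close>
    requires.\<close>
  also have "alt_sum (\<lambda>a m. a * (\<Sum>i<n. \<omega> (l[i := \<omega> (m @ [l ! i])]))) us
      = alt_sum (\<lambda>a m. a * \<omega> (m @ [\<omega> l])) us"
    using us l by (intro alt_sum_cong) (simp add: fundamental_identity)
  finally show ?thesis
    by (simp add: id_wedge_snoc us)
qed

lemma fundamental_identity_id_wedge:
  assumes us: "length us = n" and vs: "length vs = n + 1"
  shows "id_wedge scale \<omega> (us @ [id_wedge scale \<omega> vs]) =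
    slot_sum (id_wedge scale \<omega>) (\<lambda>y. id_wedge scale \<omega> (us @ [y])) vs"
proof -
  define D where "D y = id_wedge scale \<omega> (us @ [y])" for y
  define c where "c = signed n (\<omega> us)"
  have "Vector_Spaces.linear scale scale D"
    using multilinear_id_wedge us unfolding multilinear_iff D_def by simp
  then have D: "Modules.additive D"
    by (auto simp: linear_iff_module_hom module_hom_iff intro: additive.intro)
  have "slot_sum (id_wedge scale \<omega>) D vs
      = alt_sum (\<lambda>x l. D x * \<omega> l + x * slot_sum \<omega> D l) vs"
    unfolding id_wedge_eq_alt_sum slot_sum_alt_sum
    by (simp add: slot_sum_def sum_distrib_left)
  \<comment> \<open>The term \<open>- c * \<omega> l\<close> of \<open>slot_sum_id_wedge\<close>,
    times \<open>x\<close>, is exactly the defect of \<open>D\<close> on the product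
    \<open>x * \<omega> l\<close>.\<close>
  also have "\<dots> = alt_sum (\<lambda>x l. D (x * \<omega> l) + x * alt_sum (\<lambda>y m. y * \<omega> (c # m)) l) vs"
  proof (rule alt_sum_cong)
    fix x :: 'b and l :: "'b list" assume "length vs = Suc (length l)"
    with vs have l: "length l = n" by simp
    show "D x * \<omega> l + x * slot_sum \<omega> D l = D (x * \<omega> l) + x * alt_sum (\<lambda>y m. y * \<omega> (c # m)) l"
      unfolding slot_sum_id_wedge[OF us l, folded D_def c_def]
        id_wedge_snoc_mult[OF us, of x "\<omega> l", folded D_def c_def]
      by (simp add: algebra_simps)
  qed
  also have "\<dots> = D (id_wedge scale \<omega> vs)
      + alt_sum (\<lambda>x l. alt_sum (\<lambda>y m. x * (y * \<omega> (c # m))) l) vs"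
    by (simp add: alt_sum_add id_wedge_eq_alt_sum alt_sum_additive[OF D] alt_sum_mult_left)
  also have "alt_sum (\<lambda>x l. alt_sum (\<lambda>y m. x * (y * \<omega> (c # m))) l) vs = 0"
    by (rule alt_sum_symmetric) (simp add: mult.left_commute)
  finally show ?thesis by (simp add: D_def[abs_def])
qed

lemma f_identity_id_wedge: "f_identity scale (n + 1) (id_wedge scale \<omega>)"
  unfolding f_identity_iff
proof (intro allI impI)
  fix us vs :: "'b list"
  assume "length us = n + 1 - 1" and vs: "length vs = n + 1 + 1"
  then have us: "length us = n" by simp
  let ?W = "id_wedge scale \<omega>"
  have "alt_sum (\<lambda>x l. ?W (us @ [x]) * ?W l) vs =
      alt_sum (\<lambda>x l. alt_sum (\<lambda>a m. a * (\<omega> (m @ [x]) * ?W l)) us) vs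
      + signed n (\<omega> us) * alt_sum (\<lambda>x l. x * ?W l) vs"
    by (simp add: id_wedge_snoc us distrib_right alt_sum_add mult.assoc alt_sum_mult_left
        flip: alt_sum_mult_right)
  also have "alt_sum (\<lambda>x l. x * ?W l) vs = 0"
    unfolding id_wedge_eq_alt_sum alt_sum_mult_left[symmetric]
    by (rule alt_sum_symmetric) (simp add: mult.left_commute)
  \<comment> \<open>Exchanging the sums fixes \<open>m\<close>, which has \<open>n - 1\<close>
    entries and can serve in the strong identity.\<close>
  also have "alt_sum (\<lambda>x l. alt_sum (\<lambda>a m. a * (\<omega> (m @ [x]) * ?W l)) us) vs
      = alt_sum (\<lambda>a m. a * alt_sum (\<lambda>x l. \<omega> (m @ [x]) * ?W l) vs) us"
    by (subst alt_sum_swap) (simp add: alt_sum_mult_left)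
  also have "\<dots> = alt_sum (\<lambda>a m. 0) us"
  proof (rule alt_sum_cong)
    fix a :: 'b and m :: "'b list" assume m: "length us = Suc (length m)"
    have "alt_sum (\<lambda>x l. \<omega> (m @ [x]) * ?W l) vs
        = alt_sum (\<lambda>x l. alt_sum (\<lambda>y k. \<omega> (m @ [x]) * (y * \<omega> k)) l) vs"
      by (simp add: id_wedge_eq_alt_sum alt_sum_mult_left)
    \<comment> \<open>After the flip the inner variable \<open>y\<close> sits inside
      \<open>\<omega> (m @ [y])\<close>. The inner sum is then \<open>x\<close> times the strong
      identity for \<open>m\<close> and the \<open>n + 1\<close> entries of
      \<open>l\<close>.\<close>
    also have "\<dots> = - alt_sum (\<lambda>x l. alt_sum (\<lambda>y k. x * (\<omega> (m @ [y]) * \<omega> k)) l) vs"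
      by (subst alt_sum_flip) (simp add: mult.left_commute)
    also have "alt_sum (\<lambda>x l. alt_sum (\<lambda>y k. x * (\<omega> (m @ [y]) * \<omega> k)) l) vs
        = alt_sum (\<lambda>x l. 0) vs"
      using m us vs by (intro alt_sum_cong) (simp add: alt_sum_mult_left strong_alt_sum)
    finally show "a * alt_sum (\<lambda>x l. \<omega> (m @ [x]) * ?W l) vs = 0" by simp
  qed
  finally show "alt_sum (\<lambda>x l. ?W (us @ [x]) * ?W l) vs = 0" by simp
qed

lemma n_Lie_algebra_id_wedge: "n_Lie_algebra scale (n + 1) (id_wedge scale \<omega>)"
proof unfold_locales
  show "multilinear scale (n + 1) (id_wedge scale \<omega>)"
    by (rule multilinear_id_wedge)
  show "skew_symmetric scale (n + 1) (id_wedge scale \<omega>)"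
    by (rule skew_symmetric_id_wedge)
  show "id_wedge scale \<omega> (us @ [id_wedge scale \<omega> vs]) =
      (\<Sum>i<n + 1. id_wedge scale \<omega> (vs[i := id_wedge scale \<omega> (us @ [vs ! i])]))"
    if "length us = n + 1 - 1" and "length vs = n + 1" for us vs
    using fundamental_identity_id_wedge[of us vs] that by (simp add: slot_sum_def)
qed simp

end

theorem theorem6p3:
  fixes scale :: "'k::field_char_0 \<Rightarrow> 'u::comm_ring \<Rightarrow> 'u"
    and n :: nat and \<omega> :: "'u list \<Rightarrow> 'u"
  assumes "n \<ge> 1"
    and "strong_n_Lie_Poisson_algebra scale n \<omega>"
  shows "n_Lie_algebra scale (n + 1) (id_wedge scale \<omega>)
    \<and> f_identity scale (n + 1) (id_wedge scale \<omega>)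
    \<and> (\<forall>e. (\<forall>x. e * x = x) \<longrightarrow>
         (\<forall>u u' us. length us = n \<longrightarrow>
            id_wedge scale \<omega> ((u * u') # us)
              - u * id_wedge scale \<omega> (u' # us)
              - u' * id_wedge scale \<omega> (u # us)
            = - ((u * u') * id_wedge scale \<omega> (e # us))))"
proof -
  interpret strong_n_Lie_Poisson_algebra scale n \<omega>
    by (rule assms(2))
  show ?thesis
    using n_Lie_algebra_id_wedge f_identity_id_wedge id_wedge_unit by blast
qed

end
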